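(* Let $I=S\sqcup T$ be a finite set and let $\mathcal{P}$ be a poset on $I$. If $\eta$ is a nonnesting $(\mathbb{F}_q,\mathcal{P})$-set partition, then $$\Delta_{\mathcal{P}|_S,\mathcal{P}|_T}(\chi_\eta)=\frac{|U_\mathcal{P}:U_\eta|}{|U_{\mathcal{P}|_S}:U_{\eta,S}|\,|U_{\mathcal{P}|_T}:U_{\eta,T}|}\left(\sum_{\nu\in\mathrm{proj}_S^I(\eta)}\chi_\nu\right)\otimes\left(\sum_{\rho\in\mathrm{proj}_T^I(\eta)}\chi_\rho\right).$$
   Context: $\mathbb{F}_q$ is the field with $q$ elements and $\theta:\mathbb{F}_q^+\to\mathbb{C}^\times$ is a fixed nontrivial homomorphism. For a poset $\mathcal{P}$ on a finite set $I$, $\mathfrak{u}_\mathcal{P}$ is the algebra of matrices $x=(x_{ij})_{i,j\in I}$ over $\mathbb{F}_q$ with $x_{ij}=0$ unless $i\prec_\mathcal{P}j$, and $U_\mathcal{P}=\{1+x\mid x\in\mathfrak{u}_\mathcal{P}\}$ (the pattern group) with matrix multiplication; $f:U_\mathcal{P}\to\mathfrak{u}_\mathcal{P}$ is $f(1+x)=x$; $e_{ij}$ is the elementary matrix. $\mathcal{P}|_S$ is the restriction of $\mathcal{P}$ to $S\subseteq I$. An $(\mathbb{F}_q,\mathcal{P})$-set partition is a set $\eta$ of labeled arcs $i\overset{a}{\frown}j$ ($i,j\in I$, $a\in\mathbb{F}_q^\times$, at most one label for each pair) such that (1) $i\prec_\mathcal{P}j$ for every arc; (2) if $i\overset{a}{\frown}j\in\eta$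 and $i\prec_\mathcal{P}k\prec_\mathcal{P}j$, then $\eta$ has no arc from $i$ to $k$ and none from $k$ to $j$ (with any label). It is nonnesting if there are no arcs $i\overset{a}{\frown}j,k\overset{b}{\frown}l\in\eta$ with $i\prec_\mathcal{P}k\prec_\mathcal{P}l\prec_\mathcal{P}j$. For $\lambda\in\mathfrak{u}_\mathcal{P}^*$ (the dual space), $\mathrm{big}(\lambda)$ is the set of arcs $i\overset{\lambda(e_{ij})}{\frown}j$ with $i\prec_\mathcal{P}j$, $\lambda(e_{ij})\neq0$, and $\lambda(e_{kl})=0$ whenever $(k,l)\neq(i,j)$ and $k\preceq_\mathcal{P}i\prec_\mathcal{P}j\preceq_\mathcal{P}l$; it is a nonnesting $(\mathbb{F}_q,\mathcal{P})$-set partition. For a nonnesting $(\mathbb{F}_q,\mathcal{P})$-set partition $\eta$, $\chi_\eta=\sum_{\lambda\in\mathfrak{u}_\mathcal{P}^*,\ \mathrm{big}(\lambda)=\eta}\theta\circ\lambda\circ f$ (and similarly for nonnesting set partitions for $\mathcal{P}|_S$ and $\mathcal{P}|_T$). $U_\eta$ is the subgroup of all $g\in U_\mathcal{P}$ such that, for $i\neq j$, $g_{ij}=0$ whenever there exists $k\overset{a}{\frown}l\in\eta$ with $(i,j)\neq(k,l)$ and $k\preceq_\mathcal{P}i\prec_\mathcal{P}j\preceq_\mathcal{P}l$. $\sigma_{\mathcal{P}|_S,\mathcal{P}|_T}:U_{\mathcal{P}|_S}\times U_{\mathcal{P}|_T}\to U_\mathcal{P}$ sends $(g,h)$ to the matrix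 with entries $g_{ij}$ if $i,j\in S$, $h_{ij}$ if $i,j\in T$, and $0$ otherwise. $U_{\eta,S}=\{u\in U_{\mathcal{P}|_S}\mid\sigma_{\mathcal{P}|_S,\mathcal{P}|_T}(u,1)\in U_\eta\}$ and likewise $U_{\eta,T}=\{u\in U_{\mathcal{P}|_T}\mid\sigma_{\mathcal{P}|_S,\mathcal{P}|_T}(1,u)\in U_\eta\}$. For $\alpha:U_\mathcal{P}\to\mathbb{C}$, $\Delta_{\mathcal{P}|_S,\mathcal{P}|_T}(\alpha)=\alpha\circ\sigma_{\mathcal{P}|_S,\mathcal{P}|_T}$, a function on $U_{\mathcal{P}|_S}\times U_{\mathcal{P}|_T}$ regarded as an element of the tensor product of the function spaces on $U_{\mathcal{P}|_S}$ and $U_{\mathcal{P}|_T}$ via $(\alpha\otimes\beta)(g,h)=\alpha(g)\beta(h)$. For $S\subseteq I$, $\mathrm{proj}_S^I(\eta)$ is the set of nonnesting $(\mathbb{F}_q,\mathcal{P}|_S)$-set partitions $\nu$ such that (1) if $i\overset{a}{\frown}j\in\eta$ and $i,j\in S$, then $i\overset{a}{\frown}j\in\nu$; and (2) if $i\overset{a}{\frown}j\in\nu$, then there exist $k,l\in I$ with $k\overset{b}{\frown}l\in\eta$ (for some $b$) and $k\preceq_\mathcal{P}i\prec_\mathcal{P}j\preceq_\mathcal{P}l$. *)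

theory Defs
  imports Complex_Main "HOL-Algebra.Coset"
begin

text \<open>
  A poset on \<open>I\<close> is a relation \<open>P\<close> with \<^term>\<open>partial_order_on I P\<close>, so \<open>(i, j) \<in> P\<close> means
  \<open>i \<preceq> j\<close>; its restriction to \<open>S\<close> is \<open>Restr P S\<close>.  The finite field is a type of
  class \<open>{field, finite}\<close>.  A matrix with rows and columns indexed by \<open>I\<close> is a function
  of two arguments that vanishes outside \<open>I \<times> I\<close>, so the identity matrix depends on \<open>I\<close>.
\<close>

type_synonym ('i, 'q) matrix = "'i \<Rightarrow> 'i \<Rightarrow> 'q"

definition prec :: "'i rel \<Rightarrow> 'i \<Rightarrow> 'i \<Rightarrow> bool" where
  "prec P i j \<longleftrightarrow> (i, j) \<in> P \<and> i \<noteq> j"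

definition mat_one :: "'i set \<Rightarrow> ('i, 'q::field) matrix" where
  "mat_one I = (\<lambda>i j. if i \<in> I \<and> i = j then 1 else 0)"

definition elem_mat :: "'i \<Rightarrow> 'i \<Rightarrow> ('i, 'q::field) matrix" where
  "elem_mat i j = (\<lambda>k l. if k = i \<and> l = j then 1 else 0)"

definition pattern_algebra :: "'i rel \<Rightarrow> ('i, 'q::field) matrix set" where
  "pattern_algebra P = {x. \<forall>i j. \<not> prec P i j \<longrightarrow> x i j = 0}"

definition pattern_group :: "'i set \<Rightarrow> 'i rel \<Rightarrow> ('i, 'q::field) matrix monoid" where
  "pattern_group I P =
     \<lparr>carrier = {\<lambda>i j. mat_one I i j + x i j | x. x \<in> pattern_algebra P},
      monoid.mult = (\<lambda>g h i j. \<Sum>k\<in>I. g i k * h k j),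
      one = mat_one I\<rparr>"

definition f_map :: "'i set \<Rightarrow> ('i, 'q::field) matrix \<Rightarrow> ('i, 'q) matrix" where
  "f_map I g = (\<lambda>i j. g i j - mat_one I i j)"

text \<open>
  Functionals are only relevant on the pattern algebra; requiring them to be
  \<^const>\<open>extensional\<close> makes each element of the dual space a unique HOL function, so that
  sums over the dual space count every functional exactly once.
\<close>

definition dual_space :: "'i rel \<Rightarrow> (('i, 'q::field) matrix \<Rightarrow> 'q) set" where
  "dual_space P =
     {\<phi> \<in> extensional (pattern_algebra P).
        (\<forall>x \<in> pattern_algebra P. \<forall>y \<in> pattern_algebra P.
           \<phi> (\<lambda>i j. x i j + y i j) = \<phi> x + \<phi> y) \<and>
        (\<forall>c. \<forall>x \<in> pattern_algebra P. \<phi> (\<lambda>i j. c * x i j) = c * \<phi> x)}"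

text \<open>The triple \<open>(i, a, j)\<close> stands for the arc from \<open>i\<close> to \<open>j\<close> labeled \<open>a\<close>.\<close>

type_synonym ('i, 'q) arc = "'i \<times> 'q \<times> 'i"

definition set_partition :: "'i set \<Rightarrow> 'i rel \<Rightarrow> ('i, 'q::field) arc set \<Rightarrow> bool" where
  "set_partition I P \<eta> \<longleftrightarrow>
     (\<forall>i a j. (i, a, j) \<in> \<eta> \<longrightarrow> i \<in> I \<and> j \<in> I \<and> a \<noteq> 0) \<and>
     (\<forall>i a b j. (i, a, j) \<in> \<eta> \<and> (i, b, j) \<in> \<eta> \<longrightarrow> a = b) \<and>
     (\<forall>i a j. (i, a, j) \<in> \<eta> \<longrightarrow> prec P i j) \<and>
     (\<forall>i a j k. (i, a, j) \<in> \<eta> \<and> prec P i k \<and> prec P k j \<longrightarrow>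
        (\<forall>b. (i, b, k) \<notin> \<eta> \<and> (k, b, j) \<notin> \<eta>))"

definition nonnesting :: "'i rel \<Rightarrow> ('i, 'q) arc set \<Rightarrow> bool" where
  "nonnesting P \<eta> \<longleftrightarrow>
     \<not> (\<exists>i a j k b l. (i, a, j) \<in> \<eta> \<and> (k, b, l) \<in> \<eta> \<and>
          prec P i k \<and> prec P k l \<and> prec P l j)"

definition big :: "'i rel \<Rightarrow> (('i, 'q::field) matrix \<Rightarrow> 'q) \<Rightarrow> ('i, 'q) arc set" where
  "big P \<phi> =
     {(i, \<phi> (elem_mat i j), j) | i j.
        prec P i j \<and> \<phi> (elem_mat i j) \<noteq> 0 \<and>
        (\<forall>k l. (k, l) \<noteq> (i, j) \<and> (k, i) \<in> P \<and> prec P i j \<and> (j, l) \<in> P \<longrightarrow>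
           \<phi> (elem_mat k l) = 0)}"

text \<open>
  Functions on a pattern group are total HOL functions of which only the values on the
  carrier matter.
\<close>

definition chi ::
  "('q::field \<Rightarrow> complex) \<Rightarrow> 'i set \<Rightarrow> 'i rel \<Rightarrow> ('i, 'q) arc set \<Rightarrow> ('i, 'q) matrix \<Rightarrow> complex" where
  "chi \<theta> I P \<eta> = (\<lambda>g. \<Sum>\<phi> | \<phi> \<in> dual_space P \<and> big P \<phi> = \<eta>. (\<theta> \<circ> \<phi> \<circ> f_map I) g)"

definition U_sub :: "'i set \<Rightarrow> 'i rel \<Rightarrow> ('i, 'q::field) arc set \<Rightarrow> ('i, 'q) matrix set" where
  "U_sub I P \<eta> =
     {g \<in> carrier (pattern_group I P).
        \<forall>i j. i \<noteq> j \<and>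
          (\<exists>k a l. (k, a, l) \<in> \<eta> \<and> (i, j) \<noteq> (k, l) \<and> (k, i) \<in> P \<and> prec P i j \<and> (j, l) \<in> P) \<longrightarrow>
          g i j = 0}"

definition sigma ::
  "'i set \<Rightarrow> 'i set \<Rightarrow> ('i, 'q::field) matrix \<times> ('i, 'q) matrix \<Rightarrow> ('i, 'q) matrix" where
  "sigma S T = (\<lambda>(g, h) i j.
     if i \<in> S \<and> j \<in> S then g i j else if i \<in> T \<and> j \<in> T then h i j else 0)"

definition U_sub_left ::
  "'i set \<Rightarrow> 'i set \<Rightarrow> 'i rel \<Rightarrow> ('i, 'q::field) arc set \<Rightarrow> ('i, 'q) matrix set" where
  "U_sub_left S T P \<eta> =
     {u \<in> carrier (pattern_group S (Restr P S)).
        sigma S T (u, mat_one T) \<in> U_sub (S \<union> T) P \<eta>}"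

definition U_sub_right ::
  "'i set \<Rightarrow> 'i set \<Rightarrow> 'i rel \<Rightarrow> ('i, 'q::field) arc set \<Rightarrow> ('i, 'q) matrix set" where
  "U_sub_right S T P \<eta> =
     {u \<in> carrier (pattern_group T (Restr P T)).
        sigma S T (mat_one S, u) \<in> U_sub (S \<union> T) P \<eta>}"

definition Delta ::
  "'i set \<Rightarrow> 'i set \<Rightarrow> (('i, 'q::field) matrix \<Rightarrow> complex) \<Rightarrow>
   ('i, 'q) matrix \<times> ('i, 'q) matrix \<Rightarrow> complex" where
  "Delta S T \<alpha> = \<alpha> \<circ> sigma S T"

definition tensor :: "('a \<Rightarrow> complex) \<Rightarrow> ('b \<Rightarrow> complex) \<Rightarrow> 'a \<times> 'b \<Rightarrow> complex" where
  "tensor \<alpha> \<beta> = (\<lambda>(g, h). \<alpha> g * \<beta> h)"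

definition proj_set :: "'i set \<Rightarrow> 'i rel \<Rightarrow> 'i set \<Rightarrow> ('i, 'q::field) arc set \<Rightarrow> ('i, 'q) arc set set" where
  "proj_set I P S \<eta> =
     {\<nu>. set_partition S (Restr P S) \<nu> \<and> nonnesting (Restr P S) \<nu> \<and>
        (\<forall>i a j. (i, a, j) \<in> \<eta> \<and> i \<in> S \<and> j \<in> S \<longrightarrow> (i, a, j) \<in> \<nu>) \<and>
        (\<forall>i a j. (i, a, j) \<in> \<nu> \<longrightarrow>
           (\<exists>k\<in>I. \<exists>l\<in>I. \<exists>b. (k, b, l) \<in> \<eta> \<and> (k, i) \<in> P \<and> prec P i j \<and> (j, l) \<in> P))}"

definition group_index :: "('a, 'm) monoid_scheme \<Rightarrow> 'a set \<Rightarrow> nat" where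
  "group_index G H = card (rcosets\<^bsub>G\<^esub> H)"

end

theory Submission
  imports Defs "HOL-Library.Cardinality"
begin

text \<open>
  The arcs of \<open>\<eta>\<close> form an antichain for the inclusion order on intervals.  Hence
  \<open>big \<lambda> = \<eta>\<close> means that the coefficient of \<open>\<lambda>\<close> is prescribed on the arcs of \<open>\<eta>\<close>,
  arbitrary on the set \<open>Z\<close> of pairs strictly below an arc, and zero elsewhere; the condition that
  \<open>big \<lambda>\<close> lies in \<open>proj_S \<eta>\<close> says exactly the same for the pairs inside \<open>S\<close>.  Both sides
  therefore factor over pairs \<open>(i, j)\<close>.  At \<open>\<sigma>(g, h)\<close> the factors of the pairs inside \<open>S\<close>
  or inside \<open>T\<close> agree with those of \<open>g\<close> and \<open>h\<close>, while a mixed pair contributes \<open>q\<close> if it is in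
  \<open>Z\<close> and \<open>1\<close> otherwise.  The quotient of indices has the same value, because the index of
  \<open>U_\<eta>\<close> is \<open>q\<close> to the power \<open>card Z\<close>.
\<close>

section \<open>Strict pairs, prescribed zeros and restricted posets\<close>

definition strict_pairs :: "'i rel \<Rightarrow> ('i \<times> 'i) set" where
  "strict_pairs P = {(i, j). prec P i j}"

definition zero_pattern :: "'i set \<Rightarrow> 'i rel \<Rightarrow> ('i \<times> 'i) set \<Rightarrow> ('i, 'q::field) matrix set" where
  "zero_pattern I P Z = {g \<in> carrier (pattern_group I P). \<forall>(i, j)\<in>Z. g i j = 0}"

text \<open>In the entry \<open>(i, j)\<close> of a product \<open>g h\<close>, the term through a
  \<open>k\<close> strictly between \<open>i\<close> and \<open>j\<close> has the left factor
  \<open>g i k\<close>. The condition puts \<open>(i, k)\<close> into \<open>Z\<close> whenever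
  \<open>(i, j)\<close> is there, so that zeros at \<open>Z\<close> survive multiplication.\<close>

definition left_closed :: "'i rel \<Rightarrow> ('i \<times> 'i) set \<Rightarrow> bool" where
  "left_closed P Z \<longleftrightarrow> (\<forall>i j k. (i, j) \<in> Z \<and> prec P i k \<and> prec P k j \<longrightarrow> (i, k) \<in> Z)"

lemma partial_order_on_iff:
  "partial_order_on I P \<longleftrightarrow> P \<subseteq> I \<times> I \<and> (\<forall>i\<in>I. (i, i) \<in> P) \<and> trans P \<and> antisym P"
  by (auto simp: partial_order_on_def preorder_on_def refl_on_def)

lemma partial_order_on_Restr:
  assumes "partial_order_on I P" and "S \<subseteq> I"
  shows "partial_order_on S (Restr P S)"
  using assms by (auto simp: partial_order_on_iff trans_Restr antisym_def)

lemma prec_Restr [simp]: "prec (Restr P S) i j \<longleftrightarrow> prec P i j \<and> i \<in> S \<and> j \<in> S"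
  by (auto simp: prec_def)

lemma prec_memD:
  assumes "partial_order_on I P" "prec P i j"
  shows "i \<in> I" "j \<in> I" "i \<noteq> j" "(i, j) \<in> P" "(j, i) \<notin> P"
  using assms by (auto simp: partial_order_on_iff prec_def antisym_def)

lemma finite_strict_pairs:
  assumes "finite I" "partial_order_on I P"
  shows "finite (strict_pairs P)"
  by (rule finite_subset[of _ "I \<times> I"])
    (use assms in \<open>auto simp: strict_pairs_def partial_order_on_iff prec_def\<close>)

section \<open>Subgroups cut out by prescribed zeros, and their index\<close>

lemma carrier_pattern_group_iff:
  "g \<in> carrier (pattern_group I P) \<longleftrightarrow>
     (\<forall>i j. \<not> prec P i j \<longrightarrow> g i j = mat_one I i j)"
proof
  assume *: "\<forall>i j. \<not> prec P i j \<longrightarrow> g i j = mat_one I i j"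
  have "(\<lambda>i j. g i j - mat_one I i j) \<in> pattern_algebra P"
    using * by (simp add: pattern_algebra_def)
  then show "g \<in> carrier (pattern_group I P)"
    by (auto simp: pattern_group_def intro!: exI[of _ "\<lambda>i j. g i j - mat_one I i j"])
qed (auto simp: pattern_group_def pattern_algebra_def)

lemma pattern_group_diag:
  assumes "g \<in> carrier (pattern_group I P)" "i \<in> I"
  shows "g i i = 1"
  using assms by (simp add: carrier_pattern_group_iff prec_def mat_one_def)

lemma pattern_group_zero:
  assumes "g \<in> carrier (pattern_group I P)" "i \<noteq> j" "(i, j) \<notin> P"
  shows "g i j = 0"
  using assms by (simp add: carrier_pattern_group_iff prec_def mat_one_def)

lemma f_map_in_pattern_algebra:
  "g \<in> carrier (pattern_group I P) \<Longrightarrow> f_map I g \<in> pattern_algebra P"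
  by (simp add: carrier_pattern_group_iff pattern_algebra_def f_map_def)

lemma f_map_off_diag: "i \<noteq> j \<Longrightarrow> f_map I g i j = g i j"
  by (simp add: f_map_def mat_one_def)

lemma pattern_mult: "(g \<otimes>\<^bsub>pattern_group I P\<^esub> h) i j = (\<Sum>k\<in>I. g i k * h k j)"
  by (simp add: pattern_group_def)

lemma zero_pattern_mult_closed:
  fixes g h :: "('i, 'q::field) matrix"
  assumes fin: "finite I" and po: "partial_order_on I P" and Z: "left_closed P Z"
    and sub: "Z \<subseteq> strict_pairs P"
    and g: "g \<in> zero_pattern I P Z" and h: "h \<in> zero_pattern I P Z"
  shows "g \<otimes>\<^bsub>pattern_group I P\<^esub> h \<in> zero_pattern I P Z"
proof -
  have tr: "trans P" and PI: "P \<subseteq> I \<times> I" and as: "antisym P"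
    using po by (auto simp: partial_order_on_iff)
  have gc: "g \<in> carrier (pattern_group I P)" and hc: "h \<in> carrier (pattern_group I P)"
    using g h by (auto simp: zero_pattern_def)
  have gz: "g i j = 0" if "(i, j) \<in> Z" for i j
    using g that by (auto simp: zero_pattern_def)
  have hz: "h i j = 0" if "(i, j) \<in> Z" for i j
    using h that by (auto simp: zero_pattern_def)
  \<comment> \<open>Entries outside \<open>P\<close> and entries in \<open>Z\<close> are treated
    together. A \<open>k\<close> strictly between \<open>i\<close> and \<open>j\<close> forces
    \<open>(i, j) \<in> P\<close>, which leaves the second alternative, and then
    \<open>left_closed\<close> gives \<open>g i k = 0\<close>. Any other \<open>k\<close> either
    meets a zero factor or equals \<open>i\<close> or \<open>j\<close>; in the latter cases the
    factor \<open>h i j\<close> or \<open>g i j\<close> vanishes.\<close>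
  have off: "(\<Sum>k\<in>I. g i k * h k j) = 0" if ij: "i \<noteq> j" "(i, j) \<notin> P \<or> (i, j) \<in> Z" for i j
  proof (rule sum.neutral, rule ballI)
    fix k assume "k \<in> I"
    show "g i k * h k j = 0"
    proof (cases "prec P i k \<and> prec P k j")
      case True
      then have "(i, j) \<in> P"
        using tr by (meson prec_def transD)
      then have "(i, k) \<in> Z"
        using ij True Z unfolding left_closed_def by blast
      then show ?thesis by (simp add: gz)
    next
      case False
      then have "g i k = 0 \<or> h k j = 0 \<or> k = i \<or> k = j"
        using pattern_group_zero[OF gc, of i k] pattern_group_zero[OF hc, of k j]
        by (auto simp: prec_def)
      moreover have "g i j = 0" "h i j = 0"
        using ij gz hz pattern_group_zero[OF gc] pattern_group_zero[OF hc] by auto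
      ultimately show ?thesis by auto
    qed
  qed
  have diag: "(\<Sum>k\<in>I. g i k * h k i) = mat_one I i i" for i
  proof (cases "i \<in> I")
    case True
    have "(\<Sum>k\<in>I. g i k * h k i) = (\<Sum>k\<in>I. if k = i then 1 else 0)"
    proof (rule sum.cong[OF refl])
      fix k assume "k \<in> I"
      show "g i k * h k i = (if k = i then 1 else 0)"
        using pattern_group_zero[OF gc, of i k] pattern_group_zero[OF hc, of k i]
          pattern_group_diag[OF gc] pattern_group_diag[OF hc] as \<open>k \<in> I\<close>
        by (auto simp: antisym_def)
    qed
    with True fin show ?thesis by (simp add: mat_one_def)
  next
    case False
    then have "g i k = 0" if "k \<in> I" for k
      using PI pattern_group_zero[OF gc, of i k] that by auto
    with False show ?thesis by (simp add: mat_one_def)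
  qed
  have "(g \<otimes>\<^bsub>pattern_group I P\<^esub> h) i j = mat_one I i j" if "\<not> prec P i j" for i j
  proof (cases "i = j")
    case True
    then show ?thesis by (simp add: pattern_mult diag)
  next
    case False
    then show ?thesis using that off[of i j]
      by (simp add: pattern_mult prec_def mat_one_def)
  qed
  moreover have "(g \<otimes>\<^bsub>pattern_group I P\<^esub> h) i j = 0" if "(i, j) \<in> Z" for i j
  proof -
    have "i \<noteq> j" using that sub by (auto simp: strict_pairs_def prec_def)
    with that show ?thesis using off[of i j] by (simp add: pattern_mult)
  qed
  ultimately show ?thesis
    unfolding zero_pattern_def carrier_pattern_group_iff by blast
qed

text \<open>Unitriangular cancellation: the zero entry \<open>(i, j)\<close> of \<open>d g\<close>
  is \<open>d i j\<close> times the diagonal entry 1, plus terms \<open>d i k * g k j\<close> with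
  \<open>k\<close> strictly below \<open>j\<close>. Such a \<open>k\<close> has fewer strict
  predecessors than \<open>j\<close>, so induction on their number kills these terms.\<close>

lemma pattern_mult_left_cancel_zero:
  fixes d g :: "('i, 'q::field) matrix"
  assumes fin: "finite I" and po: "partial_order_on I P"
    and g: "g \<in> carrier (pattern_group I P)" and d: "d \<in> pattern_algebra P"
    and dg: "\<And>i j. (\<Sum>k\<in>I. d i k * g k j) = 0"
  shows "d i j = 0"
proof (induction "card {k. prec P k j}" arbitrary: j rule: less_induct)
  case less
  have as: "antisym P" and tr: "trans P"
    using po by (auto simp: partial_order_on_iff)
  show ?case
  proof (cases "prec P i j")
    case False
    with d show ?thesis by (simp add: pattern_algebra_def)
  next
    case True
    then have jI: "j \<in> I" using prec_memD[OF po] by blast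
    have "d i k * g k j = 0" if k: "k \<in> I" "k \<noteq> j" for k
    proof (cases "prec P k j")
      case False
      with k show ?thesis using pattern_group_zero[OF g, of k j] by (simp add: prec_def)
    next
      case True
      have "{m. prec P m k} \<subseteq> {m. prec P m j}"
        using True as tr by (auto simp: prec_def antisym_def dest: transD)
      moreover have "k \<in> {m. prec P m j} - {m. prec P m k}"
        using True by (auto simp: prec_def)
      ultimately have "{m. prec P m k} \<subset> {m. prec P m j}"
        by blast
      moreover have "finite {m. prec P m j}"
        by (rule finite_subset[OF _ fin]) (use prec_memD[OF po] in blast)
      ultimately have "card {m. prec P m k} < card {m. prec P m j}"
        by (simp add: psubset_card_mono)
      then have "d i k = 0" by (rule less)
      then show ?thesis by simp
    qed
    then have "(\<Sum>k\<in>I - {j}. d i k * g k j) = 0"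
      by (intro sum.neutral) blast
    then have "(\<Sum>k\<in>I. d i k * g k j) = d i j * g j j"
      using fin jI by (simp add: sum.remove[where x = j])
    then show ?thesis
      using dg pattern_group_diag[OF g jI] by simp
  qed
qed

lemma inj_on_pattern_mult:
  fixes g :: "('i, 'q::field) matrix"
  assumes fin: "finite I" and po: "partial_order_on I P"
    and g: "g \<in> carrier (pattern_group I P)"
  shows "inj_on (\<lambda>h. h \<otimes>\<^bsub>pattern_group I P\<^esub> g) (carrier (pattern_group I P))"
proof (rule inj_onI)
  fix h h' :: "('i, 'q) matrix"
  assume h: "h \<in> carrier (pattern_group I P)" and h': "h' \<in> carrier (pattern_group I P)"
    and eq: "h \<otimes>\<^bsub>pattern_group I P\<^esub> g = h' \<otimes>\<^bsub>pattern_group I P\<^esub> g"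
  let ?d = "\<lambda>i j. h i j - h' i j"
  have "?d \<in> pattern_algebra P"
    using h h' by (simp add: carrier_pattern_group_iff pattern_algebra_def)
  moreover have "(\<Sum>k\<in>I. ?d i k * g k j) = 0" for i j
    using fun_cong[OF fun_cong[OF eq], of i j]
    by (simp add: pattern_mult left_diff_distrib sum_subtractf)
  ultimately have "?d i j = 0" for i j
    by (rule pattern_mult_left_cancel_zero[OF fin po g])
  then show "h = h'" by (intro ext) simp
qed

text \<open>The entries on \<open>strict_pairs P - Z\<close> can be chosen freely and determine the
  matrix. The inverse map \<open>?G\<close> fills every other place from the identity matrix, which
  has the required 0 on \<open>Z\<close> because the pairs of \<open>Z\<close> are off the
  diagonal.\<close>

lemma card_zero_pattern:
  assumes fin: "finite I" and po: "partial_order_on I P" and sub: "Z \<subseteq> strict_pairs P"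
  shows "finite (zero_pattern I P Z :: ('i, 'q::{field, finite}) matrix set)"
    and "card (zero_pattern I P Z :: ('i, 'q) matrix set) = CARD('q) ^ card (strict_pairs P - Z)"
proof -
  let ?D = "strict_pairs P - Z"
  let ?H = "zero_pattern I P Z :: ('i, 'q) matrix set"
  let ?F = "?D \<rightarrow>\<^sub>E (UNIV :: 'q set)"
  let ?G = "\<lambda>c i j. if (i, j) \<in> ?D then c (i, j) else mat_one I i j"
  have "bij_betw (\<lambda>g. restrict (\<lambda>(i, j). g i j) ?D) ?H ?F"
  proof (rule bij_betw_byWitness[where f' = ?G])
    show "\<forall>g\<in>?H. ?G (restrict (\<lambda>(i, j). g i j) ?D) = g"
    proof
      fix g assume g: "g \<in> ?H"
      have "?G (restrict (\<lambda>(i, j). g i j) ?D) i j = g i j" for i j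
        using g sub
        by (auto simp: zero_pattern_def carrier_pattern_group_iff strict_pairs_def prec_def mat_one_def)
      then show "?G (restrict (\<lambda>(i, j). g i j) ?D) = g" by blast
    qed
    show "\<forall>c\<in>?F. restrict (\<lambda>(i, j). ?G c i j) ?D = c"
    proof
      fix c assume c: "c \<in> ?F"
      show "restrict (\<lambda>(i, j). ?G c i j) ?D = c"
        by (rule PiE_ext[OF _ c]) auto
    qed
    show "(\<lambda>g. restrict (\<lambda>(i, j). g i j) ?D) ` ?H \<subseteq> ?F"
      by (intro image_subsetI restrict_PiE) auto
    show "?G ` ?F \<subseteq> ?H"
      using sub
      by (auto simp: zero_pattern_def carrier_pattern_group_iff strict_pairs_def prec_def mat_one_def)
  qed
  moreover have "finite ?D"
    using finite_strict_pairs[OF fin po] by simp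
  ultimately show "finite ?H" "card ?H = CARD('q) ^ card ?D"
    by (simp_all add: bij_betw_finite bij_betw_same_card card_funcsetE finite_PiE)
qed

lemma mat_one_in_zero_pattern:
  "Z \<subseteq> strict_pairs P \<Longrightarrow> mat_one I \<in> zero_pattern I P Z"
  by (auto simp: zero_pattern_def carrier_pattern_group_iff strict_pairs_def prec_def mat_one_def)

text \<open>
  Right multiplication by an element of a finite submonoid permutes the submonoid as soon as
  it is injective, so inverses exist without inverting any matrix.
\<close>

lemma zero_pattern_left_inverse:
  fixes g :: "('i, 'q::{field, finite}) matrix"
  assumes fin: "finite I" and po: "partial_order_on I P" and Z: "left_closed P Z"
    and sub: "Z \<subseteq> strict_pairs P" and g: "g \<in> zero_pattern I P Z"
  shows "\<exists>h\<in>zero_pattern I P Z. h \<otimes>\<^bsub>pattern_group I P\<^esub> g = mat_one I"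
proof -
  let ?H = "zero_pattern I P Z :: ('i, 'q) matrix set"
  let ?m = "\<lambda>h. h \<otimes>\<^bsub>pattern_group I P\<^esub> g"
  have "?m ` ?H = ?H"
  proof (rule endo_inj_surj)
    show "finite ?H" by (rule card_zero_pattern[OF fin po sub])
    show "?m ` ?H \<subseteq> ?H" using zero_pattern_mult_closed[OF fin po Z sub _ g] by blast
    show "inj_on ?m ?H"
      by (rule inj_on_subset[OF inj_on_pattern_mult[OF fin po]]) (use g in \<open>auto simp: zero_pattern_def\<close>)
  qed
  then show ?thesis
    using mat_one_in_zero_pattern[OF sub] by (smt (verit) imageE)
qed

text \<open>Closure and left inverses for the whole pattern group thereby become the case of an
  empty \<open>Z\<close>.\<close>

lemma carrier_eq_zero_pattern: "carrier (pattern_group I P) = zero_pattern I P {}"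
  by (simp add: zero_pattern_def)

lemma group_pattern_group:
  assumes fin: "finite I" and po: "partial_order_on I P"
  shows "group (pattern_group I P :: ('i, 'q::{field, finite}) matrix monoid)"
proof -
  let ?G = "pattern_group I P :: ('i, 'q) matrix monoid"
  have Z: "left_closed P {}" "{} \<subseteq> strict_pairs P"
    by (auto simp: left_closed_def)
  have one: "one ?G = mat_one I"
    by (simp add: pattern_group_def)
  have PI: "P \<subseteq> I \<times> I"
    using po by (simp add: partial_order_on_iff)
  show ?thesis
  proof (rule groupI)
    show "g \<otimes>\<^bsub>?G\<^esub> h \<in> carrier ?G" if "g \<in> carrier ?G" "h \<in> carrier ?G" for g h
      using that zero_pattern_mult_closed[OF fin po Z] by (simp add: carrier_eq_zero_pattern)
    show "one ?G \<in> carrier ?G"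
      using mat_one_in_zero_pattern[OF Z(2)] by (simp add: one carrier_eq_zero_pattern)
    show "g \<otimes>\<^bsub>?G\<^esub> h \<otimes>\<^bsub>?G\<^esub> k = g \<otimes>\<^bsub>?G\<^esub> (h \<otimes>\<^bsub>?G\<^esub> k)" for g h k :: "('i, 'q) matrix"
    proof (intro ext)
      fix i j
      have "(\<Sum>l\<in>I. (\<Sum>m\<in>I. g i m * h m l) * k l j) = (\<Sum>m\<in>I. g i m * (\<Sum>l\<in>I. h m l * k l j))"
        unfolding sum_distrib_left sum_distrib_right
        by (subst sum.swap) (simp add: mult.assoc)
      then show "(g \<otimes>\<^bsub>?G\<^esub> h \<otimes>\<^bsub>?G\<^esub> k) i j = (g \<otimes>\<^bsub>?G\<^esub> (h \<otimes>\<^bsub>?G\<^esub> k)) i j"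
        by (simp add: pattern_mult)
    qed
    show "one ?G \<otimes>\<^bsub>?G\<^esub> g = g" if g: "g \<in> carrier ?G" for g
    proof (intro ext)
      fix i j
      have "(\<Sum>k\<in>I. mat_one I i k * g k j) = (\<Sum>k\<in>I. if k = i then g i j else 0)"
        by (rule sum.cong) (auto simp: mat_one_def)
      moreover have "g i j = 0" if "i \<notin> I"
        using that PI g[unfolded carrier_pattern_group_iff, rule_format, of i j]
        by (auto simp: prec_def mat_one_def)
      ultimately show "(one ?G \<otimes>\<^bsub>?G\<^esub> g) i j = g i j"
        using fin by (auto simp: pattern_mult one)
    qed
    show "\<exists>h\<in>carrier ?G. h \<otimes>\<^bsub>?G\<^esub> g = one ?G" if "g \<in> carrier ?G" for g
      using that zero_pattern_left_inverse[OF fin po Z] by (simp add: one carrier_eq_zero_pattern)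
  qed
qed

text \<open>By Lagrange the index is the quotient of the orders
  \<open>CARD('q) ^ card (strict_pairs P)\<close> and
  \<open>CARD('q) ^ card (strict_pairs P - Z)\<close>; each prescribed zero costs one factor
  \<open>CARD('q)\<close>.\<close>

lemma group_index_zero_pattern:
  assumes fin: "finite I" and po: "partial_order_on I P" and Z: "left_closed P Z"
    and sub: "Z \<subseteq> strict_pairs P"
  shows "group_index (pattern_group I P :: ('i, 'q::{field, finite}) matrix monoid) (zero_pattern I P Z)
    = CARD('q) ^ card Z"
proof -
  let ?G = "pattern_group I P :: ('i, 'q) matrix monoid"
  let ?H = "zero_pattern I P Z :: ('i, 'q) matrix set"
  interpret group ?G by (rule group_pattern_group[OF fin po])
  have "subgroup ?H ?G"
  proof (rule subgroupI)
    show "?H \<subseteq> carrier ?G" by (auto simp: zero_pattern_def)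
    show "?H \<noteq> {}" using mat_one_in_zero_pattern[OF sub] by blast
    show "g \<otimes>\<^bsub>?G\<^esub> h \<in> ?H" if "g \<in> ?H" "h \<in> ?H" for g h
      using zero_pattern_mult_closed[OF fin po Z sub that] .
    fix g assume g: "g \<in> ?H"
    then obtain h where h: "h \<in> ?H" "h \<otimes>\<^bsub>?G\<^esub> g = one ?G"
      using zero_pattern_left_inverse[OF fin po Z sub] by (auto simp: pattern_group_def)
    have "inv\<^bsub>?G\<^esub> g = h"
      by (rule inv_equality) (use g h in \<open>auto simp: zero_pattern_def\<close>)
    with h show "inv\<^bsub>?G\<^esub> g \<in> ?H" by simp
  qed
  then have "card (rcosets\<^bsub>?G\<^esub> ?H) * card ?H = order ?G"
    by (rule lagrange)
  moreover have "card (strict_pairs P) = card Z + card (strict_pairs P - Z)"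
    using finite_strict_pairs[OF fin po] sub
    by (metis add.commute card_Diff_subset card_mono finite_subset le_add_diff_inverse2)
  ultimately show ?thesis
    by (simp add: group_index_def order_def carrier_eq_zero_pattern power_add
        card_zero_pattern[OF fin po] card_zero_pattern[OF fin po sub])
qed

section \<open>Coefficients allowed by \<eta>\<close>

definition strictly_below :: "'i rel \<Rightarrow> ('i, 'q) arc set \<Rightarrow> ('i \<times> 'i) set" where
  "strictly_below P \<eta> = {(i, j). prec P i j \<and>
     (\<exists>k a l. (k, a, l) \<in> \<eta> \<and> (i, j) \<noteq> (k, l) \<and> (k, i) \<in> P \<and> (j, l) \<in> P)}"

text \<open>Both tests refer to \<open>P\<close> and to all of \<eta>, even when the pair is taken
  in \<open>S\<close> or \<open>T\<close>; this makes the factors on the two sides of the theorem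
  agree. For a nonnesting set partition no arc lies strictly below another, so the first two
  branches do not compete.\<close>

definition coeff_range :: "'i rel \<Rightarrow> ('i, 'q::zero) arc set \<Rightarrow> 'i \<Rightarrow> 'i \<Rightarrow> 'q set" where
  "coeff_range P \<eta> i j =
     (if (i, j) \<in> strictly_below P \<eta> then UNIV
      else if \<exists>a. (i, a, j) \<in> \<eta> then {a. (i, a, j) \<in> \<eta>} else {0})"

text \<open>If both ends differ, the arcs are nested. If exactly one end differs, condition (2) of a
  set partition, applied to the longer arc, excludes the shorter one. A pair of ends carries only
  one label.\<close>

lemma arcs_antichain:
  assumes "partial_order_on I P" "set_partition I P \<eta>" "nonnesting P \<eta>"
    and arcs: "(i, a, j) \<in> \<eta>" "(k, b, l) \<in> \<eta>" and le: "(k, i) \<in> P" "(j, l) \<in> P"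
  shows "k = i \<and> l = j \<and> a = b"
proof -
  have ij: "prec P i j"
    using assms unfolding set_partition_def by blast
  have "\<not> (k \<noteq> i \<and> l \<noteq> j)"
    using assms(3) arcs le ij unfolding nonnesting_def by (metis prec_def)
  moreover have "\<not> (k = i \<and> l \<noteq> j)" "\<not> (k \<noteq> i \<and> l = j)"
    using assms(2) arcs le ij unfolding set_partition_def by (metis prec_def)+
  ultimately have "k = i \<and> l = j" by blast
  then show ?thesis
    using assms(2) arcs unfolding set_partition_def by blast
qed

text \<open>Uniqueness of labels makes the arc branch a singleton. This cardinality is the factor
  contributed by a pair whose matrix entry is 0, because every character value there is
  \<open>\<theta> 0 = 1\<close>.\<close>

lemma card_coeff_range:
  assumes "set_partition I P \<eta>"
  shows "card (coeff_range P \<eta> i j :: 'q::{field, finite} set) =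
    (if (i, j) \<in> strictly_below P \<eta> then CARD('q) else 1)"
proof -
  have "{a. (i, a, j) \<in> \<eta>} = {b}" if "(i, b, j) \<in> \<eta>" for b
    using that assms unfolding set_partition_def by blast
  then show ?thesis
    by (auto simp: coeff_range_def)
qed

section \<open>Character sums over the dual space\<close>

lemma elem_mat_in_pattern_algebra: "prec P i j \<Longrightarrow> elem_mat i j \<in> pattern_algebra P"
  by (auto simp: pattern_algebra_def elem_mat_def)

lemma dual_space_expand:
  assumes fin: "finite (strict_pairs P)" and \<phi>: "\<phi> \<in> dual_space P" and x: "x \<in> pattern_algebra P"
  shows "\<phi> x = (\<Sum>(i, j)\<in>strict_pairs P. \<phi> (elem_mat i j) * x i j)"
proof -
  have add: "\<phi> (\<lambda>i j. y i j + z i j) = \<phi> y + \<phi> z"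
    if "y \<in> pattern_algebra P" "z \<in> pattern_algebra P" for y z
    using \<phi> that by (simp add: dual_space_def)
  have scale: "\<phi> (\<lambda>i j. c * y i j) = c * \<phi> y" if "y \<in> pattern_algebra P" for c y
    using \<phi> that by (simp add: dual_space_def)
  \<comment> \<open>Truncating \<open>x\<close> to a finite \<open>F\<close> lets additivity be
    applied one entry at a time.\<close>
  have "\<phi> (\<lambda>i j. if (i, j) \<in> F then x i j else 0) = (\<Sum>(i, j)\<in>F. \<phi> (elem_mat i j) * x i j)"
    if "finite F" "F \<subseteq> strict_pairs P" for F
    using that
  proof (induction F)
    case empty
    \<comment> \<open>Scaling by 0 supplies the value 0 at the zero matrix.\<close>
    show ?case using scale[OF x, of 0] by simp
  next
    case (insert p F)
    obtain i j where p: "p = (i, j)" by (cases p)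
    have ij: "prec P i j" using insert.prems by (simp add: p strict_pairs_def)
    have xF: "(\<lambda>i j. if (i, j) \<in> F then x i j else 0) \<in> pattern_algebra P"
      using x by (auto simp: pattern_algebra_def)
    have e: "elem_mat i j \<in> pattern_algebra P"
      using ij by (rule elem_mat_in_pattern_algebra)
    then have xe: "(\<lambda>k l. x i j * elem_mat i j k l) \<in> pattern_algebra P"
      by (auto simp: pattern_algebra_def)
    have "(\<lambda>k l. if (k, l) \<in> insert p F then x k l else 0) =
        (\<lambda>k l. x i j * elem_mat i j k l + (if (k, l) \<in> F then x k l else 0))"
      using insert.hyps by (intro ext) (auto simp: p elem_mat_def)
    then show ?case
      using insert add[OF xe xF] scale[OF e] by (simp add: p mult.commute)
  qed
  from this[OF fin] have "\<phi> (\<lambda>i j. if (i, j) \<in> strict_pairs P then x i j else 0) =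
      (\<Sum>(i, j)\<in>strict_pairs P. \<phi> (elem_mat i j) * x i j)"
    by simp
  moreover have "(\<lambda>i j. if (i, j) \<in> strict_pairs P then x i j else 0) = x"
    using x by (intro ext) (auto simp: pattern_algebra_def strict_pairs_def)
  ultimately show ?thesis by simp
qed

lemma dual_space_coordinates:
  fixes C :: "'i \<Rightarrow> 'i \<Rightarrow> 'q::field set"
  assumes fin: "finite (strict_pairs P)"
  shows "bij_betw (\<lambda>\<phi>. \<lambda>(i, j)\<in>strict_pairs P. \<phi> (elem_mat i j))
    {\<phi> \<in> dual_space P. \<forall>(i, j)\<in>strict_pairs P. \<phi> (elem_mat i j) \<in> C i j}
    (\<Pi>\<^sub>E (i, j)\<in>strict_pairs P. C i j)"
proof -
  let ?W = "strict_pairs P"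
  let ?D = "{\<phi> \<in> dual_space P. \<forall>(i, j)\<in>?W. \<phi> (elem_mat i j) \<in> C i j}"
  let ?E = "\<Pi>\<^sub>E (i, j)\<in>?W. C i j"
  \<comment> \<open>The inverse reads a coefficient vector as a linear functional. Restriction to
    \<open>pattern_algebra P\<close> makes it extensional, as \<open>dual_space\<close>
    demands.\<close>
  let ?G = "\<lambda>c. \<lambda>x\<in>pattern_algebra P. \<Sum>(i, j)\<in>?W. c (i, j) * x i j"
  have G_elem: "?G c (elem_mat i j) = c (i, j)" if ij: "(i, j) \<in> ?W" for c :: "'i \<times> 'i \<Rightarrow> 'q" and i j
  proof -
    have e: "(elem_mat i j :: ('i, 'q) matrix) \<in> pattern_algebra P"
      using ij by (intro elem_mat_in_pattern_algebra) (simp add: strict_pairs_def)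
    have "(\<Sum>(k, l)\<in>?W. c (k, l) * elem_mat i j k l) = (\<Sum>p\<in>?W. if p = (i, j) then c (i, j) else 0)"
      by (rule sum.cong) (auto simp: elem_mat_def split: if_splits)
    then show ?thesis
      using e fin ij by simp
  qed
  show ?thesis
  proof (rule bij_betw_byWitness[where f' = ?G])
    show "\<forall>\<phi>\<in>?D. ?G (\<lambda>(i, j)\<in>?W. \<phi> (elem_mat i j)) = \<phi>"
    proof
      fix \<phi> assume "\<phi> \<in> ?D"
      then have \<phi>: "\<phi> \<in> dual_space P" by simp
      show "?G (\<lambda>(i, j)\<in>?W. \<phi> (elem_mat i j)) = \<phi>"
      proof (rule extensionalityI[where A = "pattern_algebra P"])
        show "\<phi> \<in> extensional (pattern_algebra P)"
          using \<phi> by (simp add: dual_space_def)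
        fix x :: "('i, 'q) matrix" assume x: "x \<in> pattern_algebra P"
        show "?G (\<lambda>(i, j)\<in>?W. \<phi> (elem_mat i j)) x = \<phi> x"
          unfolding dual_space_expand[OF fin \<phi> x]
          using x by (auto intro!: sum.cong)
      qed simp
    qed
    show "\<forall>c\<in>?E. (\<lambda>(i, j)\<in>?W. ?G c (elem_mat i j)) = c"
    proof
      fix c assume c: "c \<in> ?E"
      show "(\<lambda>(i, j)\<in>?W. ?G c (elem_mat i j)) = c"
      proof (rule extensionalityI[where A = ?W])
        show "c \<in> extensional ?W" using c by (simp add: PiE_def)
        fix p assume "p \<in> ?W"
        then show "(\<lambda>(i, j)\<in>?W. ?G c (elem_mat i j)) p = c p"
          using G_elem by (cases p) simp
      qed simp
    qed
    show "(\<lambda>\<phi>. \<lambda>(i, j)\<in>?W. \<phi> (elem_mat i j)) ` ?D \<subseteq> ?E"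
      by (intro image_subsetI restrict_PiE) auto
    show "?G ` ?E \<subseteq> ?D"
    proof (intro image_subsetI CollectI conjI)
      fix c assume c: "c \<in> ?E"
      have "(\<lambda>i j. x i j + y i j) \<in> pattern_algebra P" "(\<lambda>i j. a * x i j) \<in> pattern_algebra P"
        if "x \<in> pattern_algebra P" "y \<in> pattern_algebra P" for x y :: "('i, 'q) matrix" and a
        using that by (auto simp: pattern_algebra_def)
      then show "?G c \<in> dual_space P"
        by (auto simp: dual_space_def case_prod_unfold ring_distribs sum.distrib
            sum_distrib_left mult.left_commute)
      show "\<forall>(i, j)\<in>?W. ?G c (elem_mat i j) \<in> C i j"
        using c G_elem by (fastforce dest: PiE_mem)
    qed
  qed
qed

lemma additive_char_sum:
  assumes add: "\<And>a b. \<theta> (a + b) = \<theta> a * \<theta> b" and "\<theta> 0 = 1" and "finite A"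
  shows "\<theta> (\<Sum>x\<in>A. f x) = (\<Prod>x\<in>A. \<theta> (f x) :: complex)"
  using \<open>finite A\<close> by induction (simp_all add: assms)

text \<open>The character \<theta> turns the coordinate expansion of \<open>\<phi> x\<close> into a
  product over strict pairs. Since \<open>C i j\<close> constrains each coordinate separately,
  distributivity exchanges the sum over coordinate vectors with that product.\<close>

lemma sum_char_dual_space:
  fixes C :: "'i \<Rightarrow> 'i \<Rightarrow> 'q::{field, finite} set" and \<theta> :: "'q \<Rightarrow> complex"
  assumes fin: "finite (strict_pairs P)" and x: "x \<in> pattern_algebra P"
    and \<theta>: "\<And>a b. \<theta> (a + b) = \<theta> a * \<theta> b" "\<theta> 0 = 1"
  shows "(\<Sum>\<phi> | \<phi> \<in> dual_space P \<and> (\<forall>(i, j)\<in>strict_pairs P. \<phi> (elem_mat i j) \<in> C i j). \<theta> (\<phi> x))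
    = (\<Prod>(i, j)\<in>strict_pairs P. \<Sum>c\<in>C i j. \<theta> (c * x i j))"
proof -
  let ?W = "strict_pairs P"
  let ?D = "{\<phi> \<in> dual_space P. \<forall>(i, j)\<in>?W. \<phi> (elem_mat i j) \<in> C i j}"
  \<comment> \<open>The summand is rewritten to depend on \<phi> only through its coordinate vector,
    the form needed for reindexing along \<open>dual_space_coordinates\<close>.\<close>
  have "(\<Sum>\<phi>\<in>?D. \<theta> (\<phi> x)) =
      (\<Sum>\<phi>\<in>?D. \<Prod>p\<in>?W. \<theta> ((\<lambda>(i, j)\<in>?W. \<phi> (elem_mat i j)) p * x (fst p) (snd p)))"
    (is "_ = (\<Sum>\<phi>\<in>?D. ?h (?r \<phi>))")
  proof (rule sum.cong[OF refl])
    fix \<phi> assume "\<phi> \<in> ?D"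
    then have \<phi>: "\<phi> \<in> dual_space P" by simp
    show "\<theta> (\<phi> x) = ?h (?r \<phi>)"
      unfolding dual_space_expand[OF fin \<phi> x] additive_char_sum[OF \<theta> fin]
      by (rule prod.cong) auto
  qed
  also have "\<dots> = (\<Sum>c\<in>(\<Pi>\<^sub>E (i, j)\<in>?W. C i j). \<Prod>p\<in>?W. \<theta> (c p * x (fst p) (snd p)))"
    by (rule sum.reindex_bij_betw[OF dual_space_coordinates[OF fin]])
  also have "\<dots> = (\<Prod>p\<in>?W. \<Sum>c\<in>(case p of (i, j) \<Rightarrow> C i j). \<theta> (c * x (fst p) (snd p)))"
    by (rule prod_sum_PiE[symmetric]) (simp_all add: fin)
  finally show ?thesis
    by (simp add: case_prod_unfold)
qed

lemma finite_dual_space: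
  assumes "finite (strict_pairs P)"
  shows "finite (dual_space P :: (('i, 'q::{field, finite}) matrix \<Rightarrow> 'q) set)"
  using bij_betw_finite[OF dual_space_coordinates[OF assms, where C = "\<lambda>_ _. UNIV :: 'q set"]]
    finite_PiE[OF assms, where T = "\<lambda>(i, j). UNIV :: 'q set"]
  by (simp add: case_prod_unfold)

section \<open>Nonzero coefficients and the arcs of \<open>big\<close>\<close>

text \<open>If \<open>(i, j)\<close> does not itself give an arc of \<open>big\<close>, a strictly
  larger pair also has a nonzero coefficient. Its interval properly contains the old one and stays
  inside the finite set \<open>I\<close>, so the ascent ends at an arc. The measure counts the
  elements of \<open>I\<close> outside the interval.\<close>

lemma big_dominates:
  assumes fin: "finite I" and po: "partial_order_on I P"
    and ij: "prec P i j" "\<phi> (elem_mat i j) \<noteq> 0"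
  shows "\<exists>k l. (k, \<phi> (elem_mat k l), l) \<in> big P \<phi> \<and> (k, i) \<in> P \<and> (j, l) \<in> P"
  using ij
proof (induction "card I - card {m. (i, m) \<in> P \<and> (m, j) \<in> P}" arbitrary: i j rule: less_induct)
  case (less i j)
  have tr: "trans P" and as: "antisym P" and PI: "P \<subseteq> I \<times> I" and rf: "\<forall>i\<in>I. (i, i) \<in> P"
    using po by (auto simp: partial_order_on_iff)
  have ijP: "(i, j) \<in> P" "i \<in> I" "j \<in> I" using less.prems prec_memD[OF po] by blast+
  show ?case
  proof (cases "(i, \<phi> (elem_mat i j), j) \<in> big P \<phi>")
    case True
    then show ?thesis using ijP rf by blast
  next
    case False
    then obtain k l where kl: "(k, l) \<noteq> (i, j)" "(k, i) \<in> P" "(j, l) \<in> P" "\<phi> (elem_mat k l) \<noteq> 0"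
      using less.prems unfolding big_def by blast
    have klp: "prec P k l"
      using kl ijP less.prems tr as unfolding prec_def by (metis antisymD transD)
    have "(k, m) \<in> P \<and> (m, l) \<in> P" if "(i, m) \<in> P" "(m, j) \<in> P" for m
      using that kl tr by (meson transD)
    then have "{m. (i, m) \<in> P \<and> (m, j) \<in> P} \<subseteq> {m. (k, m) \<in> P \<and> (m, l) \<in> P}"
      by blast
    moreover have "k \<in> {m. (k, m) \<in> P \<and> (m, l) \<in> P}" "l \<in> {m. (k, m) \<in> P \<and> (m, l) \<in> P}"
      using rf prec_memD[OF po klp] by auto
    moreover have "k \<notin> {m. (i, m) \<in> P \<and> (m, j) \<in> P} \<or> l \<notin> {m. (i, m) \<in> P \<and> (m, j) \<in> P}"
      using kl as by (auto simp: antisym_def)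
    ultimately have "{m. (i, m) \<in> P \<and> (m, j) \<in> P} \<subset> {m. (k, m) \<in> P \<and> (m, l) \<in> P}"
      by blast
    moreover have sub: "{m. (k, m) \<in> P \<and> (m, l) \<in> P} \<subseteq> I" using PI by blast
    ultimately have "card {m. (i, m) \<in> P \<and> (m, j) \<in> P} < card {m. (k, m) \<in> P \<and> (m, l) \<in> P}"
      "card {m. (k, m) \<in> P \<and> (m, l) \<in> P} \<le> card I"
      using fin by (auto intro: psubset_card_mono card_mono finite_subset)
    then have lt: "card I - card {m. (k, m) \<in> P \<and> (m, l) \<in> P}
        < card I - card {m. (i, m) \<in> P \<and> (m, j) \<in> P}"
      by linarith
    obtain k' l' where "(k', \<phi> (elem_mat k' l'), l') \<in> big P \<phi>" "(k', k) \<in> P" "(l, l') \<in> P"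
      using less.hyps[OF lt klp kl(4)] by blast
    moreover from this kl tr have "(k', i) \<in> P" "(j, l') \<in> P"
      by (meson transD)+
    ultimately show ?thesis by blast
  qed
qed

lemma big_nonnesting: "nonnesting P (big P \<phi>)"
  unfolding nonnesting_def big_def by (auto simp: prec_def)

lemma big_set_partition:
  assumes "partial_order_on I P"
  shows "set_partition I P (big P \<phi>)"
  unfolding set_partition_def
proof (intro conjI allI impI)
  have rf: "(i, i) \<in> P" if "i \<in> I" for i
    using assms that by (simp add: partial_order_on_iff)
  fix i a j k b
  assume *: "(i, a, j) \<in> big P \<phi> \<and> prec P i k \<and> prec P k j"
  \<comment> \<open>Reflexivity places \<open>(i, k)\<close> and \<open>(k, j)\<close> inside
    \<open>(i, j)\<close>, whose nonzero coefficient keeps them from being arcs of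
    \<open>big\<close>.\<close>
  then have "(i, i) \<in> P" "(j, j) \<in> P"
    using rf prec_memD[OF assms] by blast+
  then show "(i, b, k) \<notin> big P \<phi>" "(k, b, j) \<notin> big P \<phi>"
    using * unfolding big_def by (auto simp: prec_def)
qed (use prec_memD[OF assms] in \<open>auto simp: big_def\<close>)

text \<open>Membership in the projection splits into one independent condition for each pair in
  \<open>S\<close>; this independence is what makes the character sums factor.\<close>

lemma big_in_proj_set_iff:
  fixes \<eta> :: "('i, 'q::field) arc set"
  assumes fin: "finite I" and po: "partial_order_on I P" and SI: "S \<subseteq> I"
    and \<eta>: "set_partition I P \<eta>" "nonnesting P \<eta>"
  shows "big (Restr P S) \<phi> \<in> proj_set I P S \<eta> \<longleftrightarrow>
    (\<forall>(i, j)\<in>strict_pairs (Restr P S). \<phi> (elem_mat i j) \<in> coeff_range P \<eta> i j)"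
    (is "?L \<longleftrightarrow> ?R")
proof
  have poS: "partial_order_on S (Restr P S)"
    using po SI by (rule partial_order_on_Restr)
  have finS: "finite S"
    using fin SI by (rule rev_finite_subset)
  have tr: "trans P" and rf: "\<forall>i\<in>I. (i, i) \<in> P"
    using po by (auto simp: partial_order_on_iff)
  {
    assume L: ?L
    show ?R
    proof clarify
      fix i j assume "(i, j) \<in> strict_pairs (Restr P S)"
      then have ij: "prec (Restr P S) i j" by (simp add: strict_pairs_def)
      consider (below) "(i, j) \<in> strictly_below P \<eta>"
        | (arc) a where "(i, j) \<notin> strictly_below P \<eta>" "(i, a, j) \<in> \<eta>"
        | (none) "(i, j) \<notin> strictly_below P \<eta>" "\<forall>a. (i, a, j) \<notin> \<eta>"
        by blast
      then show "\<phi> (elem_mat i j) \<in> coeff_range P \<eta> i j"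
      proof cases
        case below
        then show ?thesis by (simp add: coeff_range_def)
      next
        case arc
        then have "(i, a, j) \<in> big (Restr P S) \<phi>"
          using L ij by (auto simp: proj_set_def)
        then show ?thesis
          using arc by (auto simp: coeff_range_def big_def)
      next
        case none
        \<comment> \<open>A nonzero coefficient would lie under an arc of \<open>big\<close>, and
          that arc under an arc of \<eta>. By transitivity \<open>(i, j)\<close> would be an arc of
          \<eta> or strictly below one.\<close>
        have "\<phi> (elem_mat i j) = 0"
        proof (rule ccontr)
          assume "\<phi> (elem_mat i j) \<noteq> 0"
          then obtain k l where kl: "(k, \<phi> (elem_mat k l), l) \<in> big (Restr P S) \<phi>"
            "(k, i) \<in> Restr P S" "(j, l) \<in> Restr P S"
            using big_dominates[OF finS poS ij] by blast
          then obtain k' b l' where "(k', b, l') \<in> \<eta>" "(k', k) \<in> P" "(l, l') \<in> P"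
            using L unfolding proj_set_def by blast
          moreover from this kl tr have "(k', i) \<in> P" "(j, l') \<in> P"
            by (meson IntD1 transD)+
          ultimately show False
            using none ij unfolding strictly_below_def by auto
        qed
        with none show ?thesis by (simp add: coeff_range_def)
      qed
    qed
  next
    assume R: ?R
    have range: "\<phi> (elem_mat i j) \<in> coeff_range P \<eta> i j" if "prec P i j" "i \<in> S" "j \<in> S" for i j
      using R that by (auto simp: strict_pairs_def)
    have arc_prec: "prec P i j" if "(i, a, j) \<in> \<eta>" for i a j
      using that \<eta>(1) unfolding set_partition_def by blast
    have arc_in: "i \<in> I \<and> j \<in> I" if "(i, a, j) \<in> \<eta>" for i a j
      using that \<eta>(1) unfolding set_partition_def by blast
    have arc_max: "(i, j) \<notin> strictly_below P \<eta>" if "(i, a, j) \<in> \<eta>" for i a j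
      using arcs_antichain[OF po \<eta> that] unfolding strictly_below_def by blast
    have contains: "(i, a, j) \<in> big (Restr P S) \<phi>" if arc: "(i, a, j) \<in> \<eta>" "i \<in> S" "j \<in> S" for i a j
    proof -
      have "\<phi> (elem_mat i j) \<in> coeff_range P \<eta> i j"
        using range arc arc_prec by blast
      then have eq: "\<phi> (elem_mat i j) = a"
        using arc arc_max \<eta>(1) unfolding coeff_range_def set_partition_def
        by (metis mem_Collect_eq)
      \<comment> \<open>A larger pair has range \<open>{0}\<close>. It is no arc of \<eta>, by the
        antichain property. If it lay strictly below an arc, that arc would contain
        \<open>(i, j)\<close> and hence coincide with it, and antisymmetry would collapse
        \<open>(k, l)\<close> to \<open>(i, j)\<close>.\<close>
      have "\<phi> (elem_mat k l) = 0"
        if kl: "(k, l) \<noteq> (i, j)" "(k, i) \<in> Restr P S" "(j, l) \<in> Restr P S" for k l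
      proof -
        have klp: "prec P k l"
          using kl arc_prec[OF arc(1)] po unfolding partial_order_on_iff prec_def
          by (metis IntD1 antisymD transD)
        have "(k, b, l) \<notin> \<eta>" for b
          using arcs_antichain[OF po \<eta> arc(1)] kl by blast
        moreover have "(k, l) \<notin> strictly_below P \<eta>"
        proof
          assume "(k, l) \<in> strictly_below P \<eta>"
          then obtain k' b l' where b: "(k', b, l') \<in> \<eta>" "(k', l') \<noteq> (k, l)" "(k', k) \<in> P" "(l, l') \<in> P"
            unfolding strictly_below_def by blast
          have "(k', i) \<in> P" "(j, l') \<in> P"
            using b kl tr by (meson IntD1 transD)+
          then have "k' = i \<and> l' = j"
            using arcs_antichain[OF po \<eta> arc(1) b(1)] by blast
          with b kl po show False
            by (auto simp: partial_order_on_iff antisym_def)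
        qed
        ultimately show ?thesis
          using range[OF klp] kl by (auto simp: coeff_range_def)
      qed
      moreover have "a \<noteq> 0"
        using arc \<eta>(1) unfolding set_partition_def by blast
      ultimately show ?thesis
        using arc arc_prec[OF arc(1)] eq unfolding big_def by auto
    qed
    moreover have "\<exists>k\<in>I. \<exists>l\<in>I. \<exists>b. (k, b, l) \<in> \<eta> \<and> (k, i) \<in> P \<and> prec P i j \<and> (j, l) \<in> P"
      if "(i, a, j) \<in> big (Restr P S) \<phi>" for i a j
    proof -
      have ij: "prec P i j" "i \<in> S" "j \<in> S" "\<phi> (elem_mat i j) \<noteq> 0"
        using that unfolding big_def by auto
      \<comment> \<open>A nonzero coefficient excludes the range \<open>{0}\<close>. If
        \<open>(i, j)\<close> is itself an arc of \<eta>, reflexivity lets that arc serve as the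
        containing one.\<close>
      have "(i, j) \<in> strictly_below P \<eta> \<or> (\<exists>b. (i, b, j) \<in> \<eta>)"
        using range[OF ij(1-3)] ij(4) by (auto simp: coeff_range_def split: if_splits)
      then show ?thesis
        using ij arc_in rf SI unfolding strictly_below_def by blast
    qed
    ultimately show ?L
      using big_nonnesting big_set_partition[OF poS]
      unfolding proj_set_def by blast
  }
qed

section \<open>Sums of \<open>chi\<close> over a projection\<close>

text \<open>This presents a single \<open>chi\<close> as the projection sum for
  \<open>S = I\<close>, so that one product formula serves both sides of the theorem. Any \<nu> in
  the projection contains \<eta>; conversely each arc of \<nu> lies inside an arc of \<eta>, which
  is also in \<nu>, and the antichain property of \<nu> makes the two equal.\<close>

lemma proj_set_self:
  assumes po: "partial_order_on I P" and \<eta>: "set_partition I P \<eta>" "nonnesting P \<eta>"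
  shows "proj_set I P I \<eta> = {\<eta>}"
proof -
  have R: "Restr P I = P" and rf: "\<forall>i\<in>I. (i, i) \<in> P"
    using po by (auto simp: partial_order_on_iff)
  have arcs: "i \<in> I \<and> j \<in> I \<and> prec P i j" if "(i, a, j) \<in> \<eta>" for i a j
    using that \<eta>(1) unfolding set_partition_def by blast
  have "\<nu> \<subseteq> \<eta>" if \<nu>: "\<nu> \<in> proj_set I P I \<eta>" for \<nu>
  proof clarify
    fix i a j assume a: "(i, a, j) \<in> \<nu>"
    then obtain k b l where b: "(k, b, l) \<in> \<eta>" "(k, i) \<in> P" "(j, l) \<in> P" "k \<in> I" "l \<in> I"
      using \<nu> unfolding proj_set_def by blast
    then have "(k, b, l) \<in> \<nu>" using \<nu> unfolding proj_set_def by blast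
    then have "k = i \<and> l = j \<and> a = b"
      using \<nu> arcs_antichain[OF po _ _ a _ b(2,3)] unfolding proj_set_def R by blast
    with b show "(i, a, j) \<in> \<eta>" by simp
  qed
  moreover have "\<eta> \<subseteq> \<nu>" if "\<nu> \<in> proj_set I P I \<eta>" for \<nu>
    using that arcs unfolding proj_set_def by auto
  moreover have "\<exists>k\<in>I. \<exists>l\<in>I. \<exists>b. (k, b, l) \<in> \<eta> \<and> (k, i) \<in> P \<and> prec P i j \<and> (j, l) \<in> P"
    if "(i, a, j) \<in> \<eta>" for i a j
    using arcs[OF that] that rf by blast
  then have "\<eta> \<in> proj_set I P I \<eta>"
    using \<eta> unfolding proj_set_def R by blast
  ultimately show ?thesis by blast
qed

lemma finite_proj_set:
  assumes "finite S"
  shows "finite (proj_set I P S (\<eta> :: ('i, 'q::{field, finite}) arc set))"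
  by (rule finite_subset[of _ "Pow (S \<times> UNIV \<times> S)"])
    (use assms in \<open>auto simp: proj_set_def set_partition_def\<close>)

text \<open>Each functional whose \<open>big\<close> lies in the projection occurs in exactly one
  summand, the one for \<open>\<nu> = big \<phi>\<close>. The double sum is thus a single sum over
  functionals with coefficients in \<open>coeff_range\<close>, and it factors over pairs.\<close>

lemma sum_chi_proj_set:
  fixes \<eta> :: "('i, 'q::{field, finite}) arc set" and \<theta> :: "'q \<Rightarrow> complex"
  assumes fin: "finite I" and po: "partial_order_on I P" and SI: "S \<subseteq> I"
    and \<eta>: "set_partition I P \<eta>" "nonnesting P \<eta>"
    and \<theta>: "\<And>a b. \<theta> (a + b) = \<theta> a * \<theta> b" "\<theta> 0 = 1"
    and g: "g \<in> carrier (pattern_group S (Restr P S))"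
  shows "(\<Sum>\<nu>\<in>proj_set I P S \<eta>. chi \<theta> S (Restr P S) \<nu> g) =
    (\<Prod>(i, j)\<in>strict_pairs (Restr P S). \<Sum>c\<in>coeff_range P \<eta> i j. \<theta> (c * g i j))"
proof -
  let ?R = "Restr P S"
  have poS: "partial_order_on S ?R"
    using po SI by (rule partial_order_on_Restr)
  have finS: "finite S"
    using fin SI by (rule rev_finite_subset)
  have finW: "finite (strict_pairs ?R)"
    by (rule finite_strict_pairs[OF finS poS])
  let ?D = "{\<phi> \<in> dual_space ?R. big ?R \<phi> \<in> proj_set I P S \<eta>}"
  have finD: "finite ?D"
    by (rule finite_subset[OF _ finite_dual_space[OF finW]]) blast
  have "(\<Sum>\<nu>\<in>proj_set I P S \<eta>. chi \<theta> S ?R \<nu> g) =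
      (\<Sum>\<nu>\<in>proj_set I P S \<eta>. \<Sum>\<phi> | \<phi> \<in> ?D \<and> big ?R \<phi> = \<nu>. \<theta> (\<phi> (f_map S g)))"
    by (auto simp: chi_def intro!: sum.cong)
  also have "\<dots> = (\<Sum>\<phi>\<in>?D. \<theta> (\<phi> (f_map S g)))"
    by (rule sum.group[OF finD finite_proj_set[OF finS]]) blast
  also have "\<dots> = (\<Prod>(i, j)\<in>strict_pairs ?R. \<Sum>c\<in>coeff_range P \<eta> i j. \<theta> (c * f_map S g i j))"
    unfolding big_in_proj_set_iff[OF fin po SI \<eta>]
    by (rule sum_char_dual_space[OF finW f_map_in_pattern_algebra[OF g] \<theta>])
  also have "\<dots> = (\<Prod>(i, j)\<in>strict_pairs ?R. \<Sum>c\<in>coeff_range P \<eta> i j. \<theta> (c * g i j))"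
    by (rule prod.cong) (auto simp: strict_pairs_def prec_def f_map_off_diag)
  finally show ?thesis .
qed

section \<open>The indices of \<open>U_\<eta>\<close> and its restrictions\<close>

text \<open>Moving the right end from \<open>j\<close> down to \<open>k\<close> keeps the pair
  inside the same arc. As \<open>k\<close> is strictly below \<open>j\<close> and
  \<open>j \<preceq> l\<close>, the new pair cannot be the arc itself.\<close>

lemma left_closed_strictly_below:
  assumes "partial_order_on I P"
  shows "left_closed P (strictly_below P \<eta>)"
  unfolding left_closed_def
proof (intro allI impI, elim conjE)
  fix i j k assume ij: "(i, j) \<in> strictly_below P \<eta>" and k: "prec P i k" "prec P k j"
  obtain k' a l where arc: "(k', a, l) \<in> \<eta>" "(k', i) \<in> P" "(j, l) \<in> P"
    using ij unfolding strictly_below_def by blast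
  have "(k, l) \<in> P" "k \<noteq> l"
    using k arc assms unfolding partial_order_on_iff prec_def by (metis antisymD transD)+
  with k arc show "(i, k) \<in> strictly_below P \<eta>"
    unfolding strictly_below_def by blast
qed

lemma U_sub_eq_zero_pattern: "U_sub I P \<eta> = zero_pattern I P (strictly_below P \<eta>)"
  unfolding U_sub_def zero_pattern_def strictly_below_def prec_def by blast

lemma sigma_in_carrier:
  assumes g: "g \<in> carrier (pattern_group S (Restr P S))" and h: "h \<in> carrier (pattern_group T (Restr P T))"
  shows "sigma S T (g, h) \<in> carrier (pattern_group (S \<union> T) P)"
  using assms by (auto simp: carrier_pattern_group_iff sigma_def mat_one_def prec_def)

lemma mat_one_in_carrier: "mat_one I \<in> carrier (pattern_group I P)"
  by (simp add: carrier_pattern_group_iff)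

text \<open>The prescribed zeros are the pairs of \<open>S\<close> strictly below arcs of all of
  \<eta>, including arcs with ends outside \<open>S\<close>. The identity block on \<open>T\<close>
  adds no condition, since its off-diagonal entries are 0.\<close>

lemma U_sub_left_eq_zero_pattern:
  "U_sub_left S T P \<eta> = zero_pattern S (Restr P S) (strictly_below P \<eta> \<inter> S \<times> S)"
proof -
  have "u \<in> U_sub_left S T P \<eta> \<longleftrightarrow> u \<in> zero_pattern S (Restr P S) (strictly_below P \<eta> \<inter> S \<times> S)"
    if u: "u \<in> carrier (pattern_group S (Restr P S))" for u
  proof -
    have "sigma S T (u, mat_one T) i j = (if i \<in> S \<and> j \<in> S then u i j else 0)"
      if "(i, j) \<in> strictly_below P \<eta>" for i j
      using that by (auto simp: sigma_def mat_one_def strictly_below_def prec_def)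
    then have "(\<forall>(i, j)\<in>strictly_below P \<eta>. sigma S T (u, mat_one T) i j = 0) \<longleftrightarrow>
        (\<forall>(i, j)\<in>strictly_below P \<eta> \<inter> S \<times> S. u i j = 0)"
      by fastforce
    then show ?thesis
      using u sigma_in_carrier[OF u mat_one_in_carrier, of T]
      by (simp add: U_sub_left_def U_sub_eq_zero_pattern zero_pattern_def)
  qed
  then show ?thesis
    by (auto simp: U_sub_left_def zero_pattern_def)
qed

text \<open>On disjoint sets, \<open>sigma\<close> is symmetric under exchanging both sets and
  matrices. The index on the \<open>T\<close> side is then an instance of the one on the
  \<open>S\<close> side.\<close>

lemma U_sub_right_eq_left:
  assumes "S \<inter> T = {}"
  shows "U_sub_right S T P \<eta> = U_sub_left T S P \<eta>"
proof -
  have "sigma S T (g, h) = sigma T S (h, g)" for g h :: "('a, 'b) matrix"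
    using assms by (intro ext) (auto simp: sigma_def)
  then show ?thesis
    by (simp add: U_sub_left_def U_sub_right_def Un_commute)
qed

lemma group_index_U_sub_left:
  fixes \<eta> :: "('i, 'q::{field, finite}) arc set"
  assumes "finite S" "partial_order_on I P" "S \<subseteq> I"
  shows "group_index (pattern_group S (Restr P S)) (U_sub_left S T P \<eta>) =
    CARD('q) ^ card (strictly_below P \<eta> \<inter> S \<times> S)"
  unfolding U_sub_left_eq_zero_pattern
proof (rule group_index_zero_pattern)
  show "partial_order_on S (Restr P S)"
    using assms by (intro partial_order_on_Restr)
  show "left_closed (Restr P S) (strictly_below P \<eta> \<inter> S \<times> S)"
    using left_closed_strictly_below[OF assms(2)] unfolding left_closed_def by auto
  show "strictly_below P \<eta> \<inter> S \<times> S \<subseteq> strict_pairs (Restr P S)"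
    by (auto simp: strictly_below_def strict_pairs_def)
qed (use assms in simp)

section \<open>Comparison of the two sides at \<open>sigma S T (g, h)\<close>\<close>

theorem proposition8p10:
  fixes I S T :: "'i set"
    and P :: "'i rel"
    and \<theta> :: "'q::{field, finite} \<Rightarrow> complex"
    and \<eta> :: "('i, 'q) arc set"
  assumes "\<And>a b. \<theta> (a + b) = \<theta> a * \<theta> b"
    and "\<And>a. \<theta> a \<noteq> 0"
    and "\<exists>a. \<theta> a \<noteq> 1"
    and "finite I"
    and "I = S \<union> T"
    and "S \<inter> T = {}"
    and "partial_order_on I P"
    and "set_partition I P \<eta>"
    and "nonnesting P \<eta>"
  shows "\<forall>x \<in> carrier (pattern_group S (Restr P S)) \<times> carrier (pattern_group T (Restr P T)).
    Delta S T (chi \<theta> I P \<eta>) x =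
      of_nat (group_index (pattern_group I P) (U_sub I P \<eta>)) /
      (of_nat (group_index (pattern_group S (Restr P S)) (U_sub_left S T P \<eta>)) *
       of_nat (group_index (pattern_group T (Restr P T)) (U_sub_right S T P \<eta>))) *
      tensor (\<lambda>g. \<Sum>\<nu>\<in>proj_set I P S \<eta>. chi \<theta> S (Restr P S) \<nu> g)
             (\<lambda>h. \<Sum>\<rho>\<in>proj_set I P T \<eta>. chi \<theta> T (Restr P T) \<rho> h) x"
proof clarify
  fix g h :: "('i, 'q) matrix"
  assume g: "g \<in> carrier (pattern_group S (Restr P S))" and h: "h \<in> carrier (pattern_group T (Restr P T))"
  note fin = \<open>finite I\<close> and po = \<open>partial_order_on I P\<close>
  note \<eta> = \<open>set_partition I P \<eta>\<close> \<open>nonnesting P \<eta>\<close>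
  have \<theta>0: "\<theta> 0 = 1"
    using assms(1)[of 0 0] assms(2)[of 0] by simp
  note \<theta> = assms(1) \<theta>0
  have SI: "S \<subseteq> I" and TI: "T \<subseteq> I" and finS: "finite S" and finT: "finite T"
    using assms(4,5) by auto
  have RI: "Restr P I = P"
    using po by (auto simp: partial_order_on_iff)
  let ?Z = "strictly_below P \<eta>"
  let ?q = "of_nat CARD('q) :: complex"
  let ?w = "sigma S T (g, h)"
  \<comment> \<open>\<open>?F x p\<close> is the factor of the pair \<open>p\<close> in the product
    formula; \<open>?M\<close> below collects the pairs with one end in \<open>S\<close> and the
    other in \<open>T\<close>.\<close>
  let ?F = "\<lambda>x (i, j). \<Sum>c\<in>coeff_range P \<eta> i j. \<theta> (c * x i j)"
  let ?WS = "strict_pairs (Restr P S)" and ?WT = "strict_pairs (Restr P T)"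
  let ?M = "strict_pairs P - (?WS \<union> ?WT)"
  have finW: "finite (strict_pairs P)"
    by (rule finite_strict_pairs[OF fin po])
  have subS: "?WS \<subseteq> strict_pairs P" and subT: "?WT \<subseteq> strict_pairs P" and disj: "?WS \<inter> ?WT = {}"
    using \<open>S \<inter> T = {}\<close> by (auto simp: strict_pairs_def)
  have w: "?w \<in> carrier (pattern_group I P)"
    using sigma_in_carrier[OF g h] assms(5) by simp
  \<comment> \<open>The entries of \<open>?w\<close> at mixed pairs are 0, so every summand of the
    factor is \<open>\<theta> 0 = 1\<close> and the factor is the cardinality of the range.\<close>
  have "(\<Prod>p\<in>?M. ?F ?w p) = (\<Prod>p\<in>?M. if p \<in> ?Z then ?q else 1)"
  proof (rule prod.cong[OF refl])
    fix p assume p: "p \<in> ?M"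
    obtain i j where ij: "p = (i, j)" by (cases p)
    have "?w i j = 0"
      using p by (auto simp: ij sigma_def strict_pairs_def)
    then show "?F ?w p = (if p \<in> ?Z then ?q else 1)"
      using card_coeff_range[OF \<eta>(1), of i j] \<theta>0 by (simp add: ij)
  qed
  also have "\<dots> = ?q ^ card (?M \<inter> ?Z)"
    using finW by (simp add: prod.If_cases Int_def)
  finally have mixed: "(\<Prod>p\<in>?M. ?F ?w p) = ?q ^ card (?M \<inter> ?Z)" .
  have onS: "(\<Prod>p\<in>?WS. ?F ?w p) = (\<Prod>p\<in>?WS. ?F g p)"
    by (rule prod.cong) (auto simp: strict_pairs_def sigma_def)
  have onT: "(\<Prod>p\<in>?WT. ?F ?w p) = (\<Prod>p\<in>?WT. ?F h p)"
    using \<open>S \<inter> T = {}\<close> by (intro prod.cong) (auto simp: strict_pairs_def sigma_def)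
  \<comment> \<open>The projection onto \<open>I\<close> is the singleton of \<eta>, so the product
    formula for projection sums evaluates \<open>chi\<close> itself.\<close>
  have "chi \<theta> I P \<eta> ?w = (\<Prod>p\<in>strict_pairs P. ?F ?w p)"
    using sum_chi_proj_set[OF fin po order_refl \<eta> \<theta>, unfolded RI, OF w] proj_set_self[OF po \<eta>]
    by simp
  also have "strict_pairs P = (?WS \<union> ?WT) \<union> ?M"
    using subS subT by blast
  also have "(\<Prod>p\<in>\<dots>. ?F ?w p) = (\<Prod>p\<in>?WS. ?F ?w p) * (\<Prod>p\<in>?WT. ?F ?w p) * (\<Prod>p\<in>?M. ?F ?w p)"
    using finite_subset[OF subS finW] finite_subset[OF subT finW] finW disj
    by (subst prod.union_disjoint; (subst prod.union_disjoint)?) auto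
  finally have lhs: "chi \<theta> I P \<eta> ?w = (\<Prod>p\<in>?WS. ?F g p) * (\<Prod>p\<in>?WT. ?F h p) * ?q ^ card (?M \<inter> ?Z)"
    by (simp only: onS onT mixed)
  have Z: "?Z \<subseteq> strict_pairs P"
    by (auto simp: strictly_below_def strict_pairs_def)
  have idx: "group_index (pattern_group I P) (U_sub I P \<eta>) = CARD('q) ^ card ?Z"
    unfolding U_sub_eq_zero_pattern
    by (rule group_index_zero_pattern[OF fin po left_closed_strictly_below[OF po] Z])
  have "finite ?Z"
    using Z finW by (rule finite_subset)
  \<comment> \<open>\<open>?Z\<close> splits into its parts in \<open>S\<close>, in \<open>T\<close>
    and among the mixed pairs. The first two exponents cancel in the quotient of indices, and the
    third is the power of \<open>?q\<close> found in \<open>lhs\<close>.\<close>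
  then have "card ((?Z \<inter> S \<times> S \<union> ?Z \<inter> T \<times> T) \<union> (?M \<inter> ?Z)) =
      card (?Z \<inter> S \<times> S) + card (?Z \<inter> T \<times> T) + card (?M \<inter> ?Z)"
    using \<open>S \<inter> T = {}\<close>
    by (subst card_Un_disjoint; (subst card_Un_disjoint)?)
      (auto simp: strict_pairs_def strictly_below_def)
  moreover have "(?Z \<inter> S \<times> S \<union> ?Z \<inter> T \<times> T) \<union> (?M \<inter> ?Z) = ?Z"
    using Z by (auto simp: strict_pairs_def)
  ultimately have "card ?Z = card (?Z \<inter> S \<times> S) + card (?Z \<inter> T \<times> T) + card (?M \<inter> ?Z)"
    by simp
  then show "Delta S T (chi \<theta> I P \<eta>) (g, h) =
      of_nat (group_index (pattern_group I P) (U_sub I P \<eta>)) /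
      (of_nat (group_index (pattern_group S (Restr P S)) (U_sub_left S T P \<eta>)) *
       of_nat (group_index (pattern_group T (Restr P T)) (U_sub_right S T P \<eta>))) *
      tensor (\<lambda>g. \<Sum>\<nu>\<in>proj_set I P S \<eta>. chi \<theta> S (Restr P S) \<nu> g)
             (\<lambda>h. \<Sum>\<rho>\<in>proj_set I P T \<eta>. chi \<theta> T (Restr P T) \<rho> h) (g, h)"
    by (simp add: Delta_def tensor_def lhs idx U_sub_right_eq_left[OF assms(6)] power_add
        group_index_U_sub_left[OF finS po SI] group_index_U_sub_left[OF finT po TI]
        sum_chi_proj_set[OF fin po SI \<eta> \<theta> g] sum_chi_proj_set[OF fin po TI \<eta> \<theta> h])
qed

end
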